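(* Let $\gamma_0>0$, $N_{\rm th}\ge0$, $r\in\mathbb{R}$, $\Phi\in\mathbb{R}$, $t\ge 0$, let $\mathcal{E}$ be the corresponding squeezed generalized amplitude damping (SGAD) channel on a qubit, with associated real numbers $A,B,G,H,Y$, and assume $2B+i(G-A)\neq 0$. Put $$\Psi=\sqrt{(A-G)^2+4B^2+Y^2},\qquad \eta=\sqrt{(A+G)^2+Y^2},$$ $$M_\pm=\sqrt2\sqrt{1+\left|\frac{\Psi\mp Y}{2B+i(G-A)}\right|^2},\qquad N_\pm=\sqrt2\sqrt{1+\left|\frac{Y\pm\eta}{A+G}\right|^2},$$ $$J_\pm=\frac{\sqrt{1-H\mp\Psi}}{M_\pm}\begin{pmatrix}0&1\\ \dfrac{\pm i(\Psi\mp Y)}{2B+i(G-A)}&0\end{pmatrix},\qquad K_\pm=\frac{\sqrt{1+H\mp\eta}}{N_\pm}\begin{pmatrix}-\dfrac{Y\pm\eta}{A+G}&0\\0&1\end{pmatrix}.$$ Then $J_+,J_-,K_+,K_-$ are Kraus operators for $\mathcal{E}$, namely those given by Choi's construction: for every $2\times2$ complex matrix $\rho$, $$\mathcal{E}(\rho)=J_+\rho J_+^\dagger+J_-\rho J_-^\dagger+K_+\rho K_+^\dagger+K_-\rho K_-^\dagger.$$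
   Context: Let $\sigma_x,\sigma_y,\sigma_z$ be the standard Pauli matrices. The SGAD channel describes a qubit interacting with a squeezed thermal bath. Its parameters are: the spontaneous emission rate $\gamma_0>0$; the thermal photon number $N_{\rm th}\ge 0$; the bath squeezing parameters $r,\Phi\in\mathbb{R}$; and the time $t\ge 0$. Put $$N=N_{\rm th}(\cosh^2 r+\sinh^2 r)+\sinh^2 r,\qquad a=\sinh(2r)(2N_{\rm th}+1),$$ $$A=\left[1+\tfrac12(e^{\gamma_0 a t}-1)(1+\cos\Phi)\right]e^{-\gamma_0(2N+1+a)t/2},$$ $$G=\left[1+\tfrac12(e^{\gamma_0 a t}-1)(1-\cos\Phi)\right]e^{-\gamma_0(2N+1+a)t/2},$$ $$B=\sin\Phi\,\sinh\!\left(\tfrac{\gamma_0 a t}{2}\right)e^{-\gamma_0(2N+1)t/2},\qquad H=e^{-\gamma_0(2N+1)t},\qquad Y=\frac{1-H}{2N+1}.$$ The SGAD channel is the linear map $\mathcal{E}$ on $2\times2$ complex matrices defined by $$\mathcal{E}(I)=I-Y\sigma_z,\quad \mathcal{E}(\sigma_x)=A\sigma_x-B\sigma_y,\quad \mathcal{E}(\sigma_y)=-B\sigma_x+G\sigma_y,\quad \mathcal{E}(\sigma_z)=H\sigma_z.$$ Choi's construction: the Kraus operators are obtained from orthogonal eigenvectors $v=(v_{00},v_{01},v_{10},v_{11})$ of the Choi matrix $(I\otimes\mathcal{E})(|\tilde\psi\rangle\langle\tilde\psi|)$, $|\tilde\psi\rangle=|00\rangle+|11\rangle$, with squared norm equal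 to the eigenvalue, by forming the matrix with columns $(v_{00},v_{01})^T$ and $(v_{10},v_{11})^T$. *)

theory Defs
  imports Complex_Main "Jordan_Normal_Form.Schur_Decomposition"
begin

definition pauli_x :: "complex mat" where
  "pauli_x = mat_of_rows_list 2 [[0, 1], [1, 0]]"

definition pauli_y :: "complex mat" where
  "pauli_y = mat_of_rows_list 2 [[0, - \<i>], [\<i>, 0]]"

definition pauli_z :: "complex mat" where
  "pauli_z = mat_of_rows_list 2 [[1, 0], [0, - 1]]"

definition sgad_N :: "real \<Rightarrow> real \<Rightarrow> real" where
  "sgad_N Nth r = Nth * ((cosh r)\<^sup>2 + (sinh r)\<^sup>2) + (sinh r)\<^sup>2"

definition sgad_a :: "real \<Rightarrow> real \<Rightarrow> real" where
  "sgad_a Nth r = sinh (2 * r) * (2 * Nth + 1)"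

definition sgad_A :: "real \<Rightarrow> real \<Rightarrow> real \<Rightarrow> real \<Rightarrow> real \<Rightarrow> real" where
  "sgad_A \<gamma>0 Nth r \<Phi> t =
     (1 + 1 / 2 * (exp (\<gamma>0 * sgad_a Nth r * t) - 1) * (1 + cos \<Phi>))
     * exp (- \<gamma>0 * (2 * sgad_N Nth r + 1 + sgad_a Nth r) * t / 2)"

definition sgad_G :: "real \<Rightarrow> real \<Rightarrow> real \<Rightarrow> real \<Rightarrow> real \<Rightarrow> real" where
  "sgad_G \<gamma>0 Nth r \<Phi> t =
     (1 + 1 / 2 * (exp (\<gamma>0 * sgad_a Nth r * t) - 1) * (1 - cos \<Phi>))
     * exp (- \<gamma>0 * (2 * sgad_N Nth r + 1 + sgad_a Nth r) * t / 2)"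

definition sgad_B :: "real \<Rightarrow> real \<Rightarrow> real \<Rightarrow> real \<Rightarrow> real \<Rightarrow> real" where
  "sgad_B \<gamma>0 Nth r \<Phi> t =
     sin \<Phi> * sinh (\<gamma>0 * sgad_a Nth r * t / 2) * exp (- \<gamma>0 * (2 * sgad_N Nth r + 1) * t / 2)"

definition sgad_H :: "real \<Rightarrow> real \<Rightarrow> real \<Rightarrow> real \<Rightarrow> real" where
  "sgad_H \<gamma>0 Nth r t = exp (- \<gamma>0 * (2 * sgad_N Nth r + 1) * t)"

definition sgad_Y :: "real \<Rightarrow> real \<Rightarrow> real \<Rightarrow> real \<Rightarrow> real" where
  "sgad_Y \<gamma>0 Nth r t = (1 - sgad_H \<gamma>0 Nth r t) / (2 * sgad_N Nth r + 1)"

(* Complex-linear maps on 2 x 2 matrices; values outside carrier_mat 2 2 are irrelevant. *)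
definition linear_map_mat2 :: "(complex mat \<Rightarrow> complex mat) \<Rightarrow> bool" where
  "linear_map_mat2 E \<longleftrightarrow>
     (\<forall>X \<in> carrier_mat 2 2. E X \<in> carrier_mat 2 2) \<and>
     (\<forall>X \<in> carrier_mat 2 2. \<forall>Z \<in> carrier_mat 2 2. E (X + Z) = E X + E Z) \<and>
     (\<forall>c. \<forall>X \<in> carrier_mat 2 2. E (c \<cdot>\<^sub>m X) = c \<cdot>\<^sub>m E X)"

(* The Pauli basis spans the 2 x 2 matrices, so this determines E on carrier_mat 2 2;
   see sgad_channel_exists and sgad_channel_unique. *)
definition sgad_channel ::
  "real \<Rightarrow> real \<Rightarrow> real \<Rightarrow> real \<Rightarrow> real \<Rightarrow> (complex mat \<Rightarrow> complex mat) \<Rightarrow> bool" where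
  "sgad_channel \<gamma>0 Nth r \<Phi> t E \<longleftrightarrow>
     (let A = complex_of_real (sgad_A \<gamma>0 Nth r \<Phi> t);
          B = complex_of_real (sgad_B \<gamma>0 Nth r \<Phi> t);
          G = complex_of_real (sgad_G \<gamma>0 Nth r \<Phi> t);
          H = complex_of_real (sgad_H \<gamma>0 Nth r t);
          Y = complex_of_real (sgad_Y \<gamma>0 Nth r t)
      in linear_map_mat2 E \<and>
         E (1\<^sub>m 2) = 1\<^sub>m 2 - Y \<cdot>\<^sub>m pauli_z \<and>
         E pauli_x = A \<cdot>\<^sub>m pauli_x - B \<cdot>\<^sub>m pauli_y \<and>
         E pauli_y = (- B) \<cdot>\<^sub>m pauli_x + G \<cdot>\<^sub>m pauli_y \<and>
         E pauli_z = H \<cdot>\<^sub>m pauli_z)"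

(* Basis of the two-qubit space ordered as |00>, |01>, |10>, |11>, so that id (x) E
   acts as E on each of the four 2 x 2 blocks. *)
definition id_tensor :: "(complex mat \<Rightarrow> complex mat) \<Rightarrow> complex mat \<Rightarrow> complex mat" where
  "id_tensor E X =
     (case split_block X 2 2 of (X00, X01, X10, X11) \<Rightarrow>
        four_block_mat (E X00) (E X01) (E X10) (E X11))"

definition ket_psi :: "complex vec" where
  "ket_psi = vec_of_list [1, 0, 0, 1]"

definition outer_prod :: "complex vec \<Rightarrow> complex vec \<Rightarrow> complex mat" where
  "outer_prod v w = mat (dim_vec v) (dim_vec w) (\<lambda>(i, j). v $ i * cnj (w $ j))"

definition choi_matrix :: "(complex mat \<Rightarrow> complex mat) \<Rightarrow> complex mat" where
  "choi_matrix E = id_tensor E (outer_prod ket_psi ket_psi)"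

(* The 2 x 2 matrix with columns (v00, v01) and (v10, v11). *)
definition choi_reshape :: "complex vec \<Rightarrow> complex mat" where
  "choi_reshape v = mat_of_cols 2 [vec_first v 2, vec_last v 2]"

(* Here corthogonal and eigenvector both exclude zero vectors, so four such operators come
   from an orthogonal eigenbasis; the sum of squared moduli is written v \<bullet>c v. *)
definition from_choi_construction ::
  "(complex mat \<Rightarrow> complex mat) \<Rightarrow> complex mat list \<Rightarrow> bool" where
  "from_choi_construction E Ks \<longleftrightarrow>
     (\<exists>vs. Ks = map choi_reshape vs \<and> corthogonal vs \<and>
        (\<forall>v \<in> set vs. \<exists>ev::real.
           eigenvector (choi_matrix E) v (complex_of_real ev) \<and> v \<bullet>c v = complex_of_real ev))"

lemma mat2_eq_iff:
  fixes X Z :: "complex mat"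
  assumes "X \<in> carrier_mat 2 2" "Z \<in> carrier_mat 2 2"
  shows "X = Z \<longleftrightarrow> X $$ (0,0) = Z $$ (0,0) \<and> X $$ (0,1) = Z $$ (0,1) \<and>
           X $$ (1,0) = Z $$ (1,0) \<and> X $$ (1,1) = Z $$ (1,1)"
  using assms by (auto intro!: eq_matI simp: less_2_cases_iff)

lemma pauli_carrier [simp]:
  "pauli_x \<in> carrier_mat 2 2" "pauli_y \<in> carrier_mat 2 2" "pauli_z \<in> carrier_mat 2 2"
  by (auto simp: pauli_x_def pauli_y_def pauli_z_def mat_of_rows_list_def)

lemma pauli_index [simp]:
  "pauli_x $$ (0,0) = 0" "pauli_x $$ (0,Suc 0) = 1" "pauli_x $$ (Suc 0,0) = 1" "pauli_x $$ (Suc 0,Suc 0) = 0"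
  "pauli_y $$ (0,0) = 0" "pauli_y $$ (0,Suc 0) = - \<i>" "pauli_y $$ (Suc 0,0) = \<i>" "pauli_y $$ (Suc 0,Suc 0) = 0"
  "pauli_z $$ (0,0) = 1" "pauli_z $$ (0,Suc 0) = 0" "pauli_z $$ (Suc 0,0) = 0" "pauli_z $$ (Suc 0,Suc 0) = - 1"
  by (auto simp: pauli_x_def pauli_y_def pauli_z_def mat_of_rows_list_def)

lemma pauli_dim [simp]:
  "dim_row pauli_x = 2" "dim_col pauli_x = 2" "dim_row pauli_y = 2" "dim_col pauli_y = 2"
  "dim_row pauli_z = 2" "dim_col pauli_z = 2"
  by (auto simp: pauli_x_def pauli_y_def pauli_z_def mat_of_rows_list_def)

lemma pauli_expansion:
  fixes X :: "complex mat"
  assumes "X \<in> carrier_mat 2 2"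
  shows "X = ((X $$ (0,0) + X $$ (1,1)) / 2) \<cdot>\<^sub>m 1\<^sub>m 2 + ((X $$ (0,1) + X $$ (1,0)) / 2) \<cdot>\<^sub>m pauli_x
           + (\<i> * (X $$ (0,1) - X $$ (1,0)) / 2) \<cdot>\<^sub>m pauli_y
           + ((X $$ (0,0) - X $$ (1,1)) / 2) \<cdot>\<^sub>m pauli_z"
  using assms by (subst mat2_eq_iff) (auto simp: field_simps)

lemma linear_map_mat2_expand:
  assumes "linear_map_mat2 E" "X \<in> carrier_mat 2 2"
  shows "E X = ((X $$ (0,0) + X $$ (1,1)) / 2) \<cdot>\<^sub>m E (1\<^sub>m 2)
           + ((X $$ (0,1) + X $$ (1,0)) / 2) \<cdot>\<^sub>m E pauli_x
           + (\<i> * (X $$ (0,1) - X $$ (1,0)) / 2) \<cdot>\<^sub>m E pauli_y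
           + ((X $$ (0,0) - X $$ (1,1)) / 2) \<cdot>\<^sub>m E pauli_z"
proof -
  have add: "E (P + Q) = E P + E Q" if "P \<in> carrier_mat 2 2" "Q \<in> carrier_mat 2 2" for P Q
    using assms(1) that by (auto simp: linear_map_mat2_def)
  have smult: "E (c \<cdot>\<^sub>m P) = c \<cdot>\<^sub>m E P" if "P \<in> carrier_mat 2 2" for c P
    using assms(1) that by (auto simp: linear_map_mat2_def)
  show ?thesis
    by (subst pauli_expansion[OF assms(2)]) (simp add: add smult)
qed

lemma sgad_channel_unique:
  assumes "sgad_channel \<gamma>0 Nth r \<Phi> t E" "sgad_channel \<gamma>0 Nth r \<Phi> t E'" "X \<in> carrier_mat 2 2"
  shows "E X = E' X"
  using assms linear_map_mat2_expand[of E X] linear_map_mat2_expand[of E' X]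
  by (simp add: sgad_channel_def Let_def)

lemma sgad_channel_exists: "\<exists>E. sgad_channel \<gamma>0 Nth r \<Phi> t E"
proof -
  define A B G H Y where "A = complex_of_real (sgad_A \<gamma>0 Nth r \<Phi> t)"
    and "B = complex_of_real (sgad_B \<gamma>0 Nth r \<Phi> t)"
    and "G = complex_of_real (sgad_G \<gamma>0 Nth r \<Phi> t)"
    and "H = complex_of_real (sgad_H \<gamma>0 Nth r t)"
    and "Y = complex_of_real (sgad_Y \<gamma>0 Nth r t)"
  define E :: "complex mat \<Rightarrow> complex mat" where
    "E X = ((X $$ (0,0) + X $$ (1,1)) / 2) \<cdot>\<^sub>m (1\<^sub>m 2 - Y \<cdot>\<^sub>m pauli_z)
           + ((X $$ (0,1) + X $$ (1,0)) / 2) \<cdot>\<^sub>m (A \<cdot>\<^sub>m pauli_x - B \<cdot>\<^sub>m pauli_y)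
           + (\<i> * (X $$ (0,1) - X $$ (1,0)) / 2) \<cdot>\<^sub>m ((- B) \<cdot>\<^sub>m pauli_x + G \<cdot>\<^sub>m pauli_y)
           + ((X $$ (0,0) - X $$ (1,1)) / 2) \<cdot>\<^sub>m (H \<cdot>\<^sub>m pauli_z)" for X
  have carr: "E X \<in> carrier_mat 2 2" for X by (auto simp: E_def)
  have "linear_map_mat2 E"
    unfolding linear_map_mat2_def
  proof (intro conjI ballI allI)
    fix X Z :: "complex mat" assume XZ: "X \<in> carrier_mat 2 2" "Z \<in> carrier_mat 2 2"
    show "E (X + Z) = E X + E Z"
      using XZ carr by (subst mat2_eq_iff) (auto simp: E_def field_simps)
  next
    fix c and X :: "complex mat" assume "X \<in> carrier_mat 2 2"
    then show "E (c \<cdot>\<^sub>m X) = c \<cdot>\<^sub>m E X"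
      using carr by (subst mat2_eq_iff) (auto simp: E_def field_simps)
  qed (rule carr)
  moreover have "E (1\<^sub>m 2) = 1\<^sub>m 2 - Y \<cdot>\<^sub>m pauli_z"
    "E pauli_x = A \<cdot>\<^sub>m pauli_x - B \<cdot>\<^sub>m pauli_y"
    "E pauli_y = (- B) \<cdot>\<^sub>m pauli_x + G \<cdot>\<^sub>m pauli_y"
    "E pauli_z = H \<cdot>\<^sub>m pauli_z"
    using carr by (subst mat2_eq_iff; auto simp: E_def field_simps)+
  ultimately show ?thesis
    unfolding sgad_channel_def Let_def A_def B_def G_def H_def Y_def by blast
qed

end

(* With u = gamma0 a t / 2, tau = gamma0 (2N+1) t / 2 and k = tanh (2r) = u / tau, one finds
   A + G = 2 exp(-tau) cosh u and (A - G)^2 + 4 B^2 = 4 exp(-2 tau) sinh^2 u.  All four eigenvalues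
   of the Choi matrix are positive because sinh^2 (k tau) < k^2 sinh^2 tau (strict convexity of sinh)
   and k^2 <= 1 - 1/(2N+1)^2.  The Choi matrix is a direct sum of two Hermitian 2x2 blocks, on
   span(|01>,|10>) and span(|00>,|11>), whose spectral decompositions give the J's and the K's. *)
theory Submission
  imports Defs
begin

section \<open>Strict positivity of the Choi eigenvalues\<close>

text \<open>By strict convexity on the positive axis, sinh lies strictly below its chords from the
  origin. In derivative form this is cosh (k x) < cosh x for x > 0.\<close>

lemma sinh_mult_less:
  fixes k \<tau> :: real
  assumes "0 < k" "k < 1" "0 < \<tau>"
  shows "sinh (k * \<tau>) < k * sinh \<tau>"
proof -
  have "(\<lambda>x. k * sinh x - sinh (k * x)) 0 < (\<lambda>x. k * sinh x - sinh (k * x)) \<tau>"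
  proof (rule DERIV_pos_imp_increasing_open[OF \<open>0 < \<tau>\<close>])
    fix x :: real
    assume x: "0 < x" "x < \<tau>"
    have "((\<lambda>x. k * sinh x - sinh (k * x)) has_real_derivative k * (cosh x - cosh (k * x))) (at x)"
      by (auto intro!: derivative_eq_intros simp: algebra_simps)
    moreover have "cosh (k * x) < cosh x"
      using assms x by (intro cosh_real_strict_mono) auto
    ultimately show "\<exists>y. ((\<lambda>x. k * sinh x - sinh (k * x)) has_real_derivative y) (at x) \<and> 0 < y"
      using assms by fastforce
  qed (auto intro!: continuous_intros)
  then show ?thesis by simp
qed

text \<open>Since sinh is odd, its square depends only on \<open>\<bar>k\<bar>\<close>; so negative
  k, which comes from negative squeezing r, reduces to \<open>sinh_mult_less\<close>.\<close>

lemma sinh_sq_mult_less: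
  fixes k \<tau> :: real
  assumes "k \<noteq> 0" "\<bar>k\<bar> < 1" "0 < \<tau>"
  shows "(sinh (k * \<tau>))\<^sup>2 < k\<^sup>2 * (sinh \<tau>)\<^sup>2"
proof -
  have "(sinh (\<bar>k\<bar> * \<tau>))\<^sup>2 < (\<bar>k\<bar> * sinh \<tau>)\<^sup>2"
    using sinh_mult_less[of "\<bar>k\<bar>" \<tau>] assms by (intro power_strict_mono) auto
  then show ?thesis
    by (cases "k > 0") (auto simp: power_mult_distrib)
qed

text \<open>As \<open>sgad_a\<close> is the same multiple of \<open>sinh (2 * r)\<close>, the ratio
  of a to 2N + 1 is \<open>tanh (2 * r)\<close>, whatever the thermal photon number.\<close>

lemma sgad_N_eq: "2 * sgad_N Nth r + 1 = (2 * Nth + 1) * cosh (2 * r)"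
proof -
  have "cosh (2 * r) = 2 * (sinh r)\<^sup>2 + 1" "(cosh r)\<^sup>2 = (sinh r)\<^sup>2 + 1"
    by (simp_all add: cosh_double cosh_square_eq)
  then show ?thesis by (simp add: sgad_N_def algebra_simps)
qed

text \<open>With u as in the proof, the bracket in \<open>sgad_A\<close> is exp u times (cosh u +
  cos \<Phi> sinh u), and exp u cancels against the exp (- u) contained in the other factor.\<close>

lemma sgad_A_eq:
  "sgad_A \<gamma>0 Nth r \<Phi> t = exp (- (\<gamma>0 * (2 * sgad_N Nth r + 1) * t / 2)) *
     (cosh (\<gamma>0 * sgad_a Nth r * t / 2) + cos \<Phi> * sinh (\<gamma>0 * sgad_a Nth r * t / 2))"
proof -
  define u \<tau> where "u = \<gamma>0 * sgad_a Nth r * t / 2" and "\<tau> = \<gamma>0 * (2 * sgad_N Nth r + 1) * t / 2"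
  have *: "exp (\<gamma>0 * sgad_a Nth r * t) = exp u * exp u"
    "exp (- \<gamma>0 * (2 * sgad_N Nth r + 1 + sgad_a Nth r) * t / 2) = exp (- \<tau>) * exp (- u)"
    unfolding mult_exp_exp by (auto simp: u_def \<tau>_def field_simps)
  show ?thesis
    unfolding sgad_A_def * u_def[symmetric] \<tau>_def[symmetric]
    by (simp add: cosh_field_def sinh_field_def field_simps exp_minus)
qed

lemma sgad_G_eq:
  "sgad_G \<gamma>0 Nth r \<Phi> t = exp (- (\<gamma>0 * (2 * sgad_N Nth r + 1) * t / 2)) *
     (cosh (\<gamma>0 * sgad_a Nth r * t / 2) - cos \<Phi> * sinh (\<gamma>0 * sgad_a Nth r * t / 2))"
  \<comment> \<open>Replacing \<Phi> by pi - \<Phi> flips the sign of the cosine and turns A into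
    G.\<close>
  using sgad_A_eq[of \<gamma>0 Nth r "pi - \<Phi>" t] by (simp add: sgad_A_def sgad_G_def)

text \<open>The first two bounds make the radicands in J and K positive for both signs; the third
  licenses division by A + G. The assumption \<open>ne\<close> secures strictness: at t = 0, for
  example, both sides of the first bound are 0.\<close>

lemma sgad_eigenvalues_pos:
  assumes "\<gamma>0 > 0" "Nth \<ge> 0" "t \<ge> 0"
    and A: "A = sgad_A \<gamma>0 Nth r \<Phi> t" and B: "B = sgad_B \<gamma>0 Nth r \<Phi> t"
    and G: "G = sgad_G \<gamma>0 Nth r \<Phi> t" and H: "H = sgad_H \<gamma>0 Nth r t" and Y: "Y = sgad_Y \<gamma>0 Nth r t"
    and ne: "B \<noteq> 0 \<or> A \<noteq> G"
  shows "sqrt ((A - G)\<^sup>2 + 4 * B\<^sup>2 + Y\<^sup>2) < 1 - H"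
    and "sqrt ((A + G)\<^sup>2 + Y\<^sup>2) < 1 + H"
    and "0 < A + G"
proof -
  define n m k \<tau> h where "n = 2 * Nth + 1" and "m = n * cosh (2 * r)" and "k = tanh (2 * r)"
    and "\<tau> = \<gamma>0 * m * t / 2" and "h = exp (- \<tau>)"
  have m: "2 * sgad_N Nth r + 1 = m"
    by (simp add: sgad_N_eq m_def n_def)
  have u: "\<gamma>0 * sgad_a Nth r * t / 2 = k * \<tau>"
    by (simp add: sgad_a_def \<tau>_def k_def m_def n_def tanh_def)
  have "1 \<le> n" using assms by (simp add: n_def)
  then have "1 \<le> m"
    using cosh_real_ge_1[of "2 * r"] mult_mono[of 1 n 1 "cosh (2 * r)"] by (simp add: m_def)
  have A': "A = h * (cosh (k * \<tau>) + cos \<Phi> * sinh (k * \<tau>))"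
    and G': "G = h * (cosh (k * \<tau>) - cos \<Phi> * sinh (k * \<tau>))"
    unfolding A G sgad_A_eq sgad_G_eq m u by (simp_all add: h_def \<tau>_def)
  have B': "B = h * sin \<Phi> * sinh (k * \<tau>)"
    unfolding B sgad_B_def m u by (simp add: h_def \<tau>_def)
  have H': "H = h\<^sup>2"
    unfolding H sgad_H_def m by (simp add: h_def \<tau>_def flip: exp_double)
  have Y': "Y = (1 - H) / m"
    unfolding Y sgad_Y_def m H ..
  have "h > 0" by (simp add: h_def)
  have "exp \<tau> = 1 / h" by (simp add: h_def exp_minus field_simps)
  \<comment> \<open>H is the square of h, so 1 - H = h (1/h - h) and 1 + H = h (1/h + h).\<close>
  then have H1: "1 - H = 2 * h * sinh \<tau>" "1 + H = 2 * h * cosh \<tau>"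
    unfolding H' sinh_field_def cosh_field_def h_def[symmetric]
    using \<open>h > 0\<close> by (simp_all add: field_simps power2_eq_square)
  \<comment> \<open>Otherwise every sinh term vanishes, forcing B = 0 and A = G.\<close>
  have "k * \<tau> \<noteq> 0" using ne by (auto simp: A' G' B')
  then have "k \<noteq> 0" "\<tau> > 0"
    using assms \<open>1 \<le> m\<close> by (auto simp: \<tau>_def less_le)
  have "\<bar>k\<bar> < 1"
    using tanh_real_lt_1[of "2 * r"] tanh_real_gt_neg1[of "2 * r"] by (simp add: k_def abs_less_iff)
  have "k\<^sup>2 = 1 - 1 / (cosh (2 * r))\<^sup>2"
    using cosh_real_pos[of "2 * r"]
    by (simp add: k_def tanh_def power_divide sinh_square_eq diff_divide_distrib)
  \<comment> \<open>Thermal photons only raise m above cosh (2 r), its value at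
    \<open>Nth = 0\<close>.\<close>
  also have "\<dots> \<le> 1 - 1 / m\<^sup>2"
  proof -
    have "cosh (2 * r) \<le> m"
      using \<open>1 \<le> n\<close> by (simp add: m_def)
    then show ?thesis
      using cosh_real_pos[of "2 * r"] by (auto intro!: frac_le power_mono)
  qed
  finally have "k\<^sup>2 * (sinh \<tau>)\<^sup>2 \<le> (1 - 1 / m\<^sup>2) * (sinh \<tau>)\<^sup>2"
    by (intro mult_right_mono) auto
  \<comment> \<open>Scaled by \<open>4 * h\<^sup>2\<close> this is the squared first bound. Adding 1
    to both sides turns the two outer squares into squares of cosh, which gives the second.\<close>
  then have key: "(sinh (k * \<tau>))\<^sup>2 + (sinh \<tau>)\<^sup>2 / m\<^sup>2 < (sinh \<tau>)\<^sup>2"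
    using sinh_sq_mult_less[OF \<open>k \<noteq> 0\<close> \<open>\<bar>k\<bar> < 1\<close> \<open>\<tau> > 0\<close>] by (simp add: algebra_simps)
  \<comment> \<open>A - G carries cos \<Phi> and 2 B carries sin \<Phi> with the same amplitude, so
    the phase drops out.\<close>
  have "(h * (C + c * S) - h * (C - c * S))\<^sup>2 + 4 * (h * d * S)\<^sup>2 = 4 * h\<^sup>2 * S\<^sup>2 * (d\<^sup>2 + c\<^sup>2)"
    for C S c d :: real by (simp add: power2_eq_square algebra_simps)
  then have AGB: "(A - G)\<^sup>2 + 4 * B\<^sup>2 = 4 * h\<^sup>2 * (sinh (k * \<tau>))\<^sup>2"
    unfolding A' G' B' by simp
  have Y2: "Y\<^sup>2 = 4 * h\<^sup>2 * ((sinh \<tau>)\<^sup>2 / m\<^sup>2)"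
    unfolding Y' H1 by (simp add: power_divide power_mult_distrib)
  have AG: "A + G = 2 * h * cosh (k * \<tau>)" by (simp add: A' G' algebra_simps)
  then show "0 < A + G" using \<open>h > 0\<close> by simp
  have "(A - G)\<^sup>2 + 4 * B\<^sup>2 + Y\<^sup>2 < (1 - H)\<^sup>2"
    using mult_strict_left_mono[OF key, of "4 * h\<^sup>2"] \<open>h > 0\<close>
    unfolding AGB Y2 H1 by (simp add: algebra_simps power_mult_distrib)
  then show "sqrt ((A - G)\<^sup>2 + 4 * B\<^sup>2 + Y\<^sup>2) < 1 - H"
    using H1 \<open>h > 0\<close> \<open>\<tau> > 0\<close> by (intro real_less_lsqrt) auto
  have "(A + G)\<^sup>2 + Y\<^sup>2 < (1 + H)\<^sup>2"
    using mult_strict_left_mono[OF key, of "4 * h\<^sup>2"] \<open>h > 0\<close>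
    unfolding AG Y2 H1 by (simp add: algebra_simps power_mult_distrib cosh_square_eq)
  then show "sqrt ((A + G)\<^sup>2 + Y\<^sup>2) < 1 + H"
    using H1 \<open>h > 0\<close> by (intro real_less_lsqrt) auto
qed

section \<open>Spectral decomposition of a Hermitian 2x2 block\<close>

text \<open>Spectral decomposition of the block with rows \<open>(p + Y, - cnj w) / 2\<close> and
  \<open>(- w, p - Y) / 2\<close>: the eigenvalues are \<open>(p - s R) / 2\<close> for a sign \<open>s\<close> (encoded as
  \<open>s\<^sup>2 = 1\<close>), with eigenvectors \<open>c s (x s, 1)\<close>.\<close>

lemma hermitian_block:
  fixes w :: complex and p Y R :: real
  assumes w: "w \<noteq> 0" and R: "R = sqrt ((cmod w)\<^sup>2 + Y\<^sup>2)" and p: "R < p"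
    and x: "\<And>s. x s = complex_of_real (s * R - Y) / w"
    and c: "\<And>s. c s = sqrt (p - s * R) / (sqrt 2 * sqrt (1 + (cmod (x s))\<^sup>2))"
  shows "s\<^sup>2 = 1 \<Longrightarrow> 0 < c s"
    and "s\<^sup>2 = 1 \<Longrightarrow> of_real ((p + Y) / 2) * (of_real (c s) * x s) + - cnj w / 2 * of_real (c s)
      = complex_of_real ((p - s * R) / 2) * (of_real (c s) * x s)"
    and "s\<^sup>2 = 1 \<Longrightarrow> - w / 2 * (of_real (c s) * x s) + of_real ((p - Y) / 2) * of_real (c s)
      = complex_of_real ((p - s * R) / 2) * of_real (c s)"
    and "s\<^sup>2 = 1 \<Longrightarrow> (of_real (c s))\<^sup>2 * (x s * cnj (x s) + 1) = complex_of_real ((p - s * R) / 2)"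
    and "x 1 * cnj (x (- 1)) = - 1"
    and "(of_real (c 1))\<^sup>2 + (of_real (c (- 1)))\<^sup>2 = complex_of_real ((p - Y) / 2)"
    and "(of_real (c 1))\<^sup>2 * x 1 + (of_real (c (- 1)))\<^sup>2 * x (- 1) = - cnj w / 2"
    and "(of_real (c 1))\<^sup>2 * (x 1 * cnj (x 1)) + (of_real (c (- 1)))\<^sup>2 * (x (- 1) * cnj (x (- 1)))
         = complex_of_real ((p + Y) / 2)"
proof -
  have R2: "R\<^sup>2 = (cmod w)\<^sup>2 + Y\<^sup>2" by (simp add: R)
  have "(cmod w)\<^sup>2 > 0" using w by simp
  \<comment> \<open>Because w is nonzero, Y lies strictly between - R and R; this keeps R + s Y and
    R - s Y positive, so both can be cancelled below.\<close>
  then have "\<bar>Y\<bar> < R" unfolding R by (intro real_less_rsqrt) simp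
  have ww: "w * cnj w = complex_of_real (R\<^sup>2 - Y\<^sup>2)"
    by (simp add: R2 complex_norm_square del: of_real_power)
  have sR: "p - s * R > 0" "0 < R + s * Y" "0 < R - s * Y" and s: "s = 1 \<or> s = - 1" if "s\<^sup>2 = 1" for s
    using that p \<open>\<bar>Y\<bar> < R\<close> by (auto simp: power2_eq_1_iff)
  have pos: "1 + (cmod z)\<^sup>2 > 0" for z by (simp add: add_pos_nonneg)
  show "0 < c s" if "s\<^sup>2 = 1" for s
    unfolding c using sR[OF that] pos[of "x s"] by auto
  have wx: "w * x s = complex_of_real (s * R - Y)" for s
    using w by (simp add: x)
  \<comment> \<open>The second row of the eigenvalue equation is just the definition of x. The first
    row needs the equivalent form x = cnj w / (Y + s R), valid because w cnj w is the difference of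
    the squares of s R and Y.\<close>
  have xw: "complex_of_real (Y + s * R) * x s = cnj w" if "s\<^sup>2 = 1" for s
  proof -
    have "w * (complex_of_real (Y + s * R) * x s) = complex_of_real (Y + s * R) * (w * x s)"
      by (simp add: ac_simps)
    also have "\<dots> = complex_of_real ((s * R)\<^sup>2 - Y\<^sup>2)"
      unfolding wx by (simp add: algebra_simps power2_eq_square)
    also have "(s * R)\<^sup>2 = R\<^sup>2" using that by (simp add: power_mult_distrib)
    finally show ?thesis using ww w by (metis mult_cancel_left)
  qed
  show "of_real ((p + Y) / 2) * (of_real (c s) * x s) + - cnj w / 2 * of_real (c s)
      = complex_of_real ((p - s * R) / 2) * (of_real (c s) * x s)" if "s\<^sup>2 = 1" for s
    unfolding xw[OF that, symmetric] by (simp add: field_simps)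
  have "- w / 2 * (of_real (c s) * x s) = complex_of_real ((Y - s * R) / 2) * of_real (c s)" for s
    using w by (simp add: x field_simps)
  then show "- w / 2 * (of_real (c s) * x s) + of_real ((p - Y) / 2) * of_real (c s)
      = complex_of_real ((p - s * R) / 2) * of_real (c s)" for s
    by (simp only: flip: distrib_right of_real_add) (simp add: field_simps)
  \<comment> \<open>This is Choi's normalisation: \<open>c s\<close> makes the squared norm of the
    eigenvector equal to its eigenvalue, and sqrt 2 supplies the half.\<close>
  have lam: "(c s)\<^sup>2 * (1 + (cmod (x s))\<^sup>2) = (p - s * R) / 2" if "s\<^sup>2 = 1" for s
    unfolding c using sR[OF that] pos[of "x s"]
    by (simp add: power_divide power_mult_distrib del: distrib_left_numeral)
  show "(of_real (c s))\<^sup>2 * (x s * cnj (x s) + 1) = complex_of_real ((p - s * R) / 2)" if "s\<^sup>2 = 1" for s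
    unfolding lam[OF that, symmetric] complex_norm_square[symmetric] by (simp add: add.commute)
  \<comment> \<open>Since s R - Y = s (R - s Y), one factor R - s Y cancels against the squared
    modulus of w.\<close>
  have x2: "(cmod (x s))\<^sup>2 = (R - s * Y) / (R + s * Y)" if "s\<^sup>2 = 1" for s
  proof -
    have "(cmod (x s))\<^sup>2 = (s * R - Y)\<^sup>2 / (R\<^sup>2 - Y\<^sup>2)"
      by (simp add: x norm_divide power_divide R2 del: of_real_diff of_real_mult)
    also have "(s * R - Y)\<^sup>2 = (R - s * Y) * (R - s * Y)"
      using s[OF that] by (auto simp: power2_eq_square algebra_simps)
    also have "R\<^sup>2 - Y\<^sup>2 = (R - s * Y) * (R + s * Y)"
      using s[OF that] by (auto simp: power2_eq_square algebra_simps)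
    also have "(R - s * Y) * (R - s * Y) / ((R - s * Y) * (R + s * Y)) = (R - s * Y) / (R + s * Y)"
      using sR[OF that] by simp
    finally show ?thesis .
  qed
  \<comment> \<open>With the roots gone, the squared weights are rational in p, R, Y, so the sums
    over the two signs can be computed directly.\<close>
  have c2: "(c s)\<^sup>2 = (p - s * R) * (R + s * Y) / (4 * R)" if "s\<^sup>2 = 1" for s
  proof -
    have "1 + (cmod (x s))\<^sup>2 = 2 * R / (R + s * Y)"
      using sR[OF that] by (simp add: x2[OF that] field_simps)
    then show ?thesis
      using lam[OF that] sR[OF that] \<open>\<bar>Y\<bar> < R\<close> by (simp add: field_simps)
  qed
  have cx: "complex_of_real ((c s)\<^sup>2) * x s = complex_of_real ((s * p - R) / (4 * R)) * cnj w"
    if "s\<^sup>2 = 1" for s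
  proof -
    \<comment> \<open>Pulling a factor s out of both p - s R and R + s Y exposes Y + s R, which
      \<open>xw\<close> absorbs.\<close>
    have "(c s)\<^sup>2 = (s * p - R) / (4 * R) * (Y + s * R)"
      using s[OF that] c2[OF that] by (auto simp: field_simps)
    then have "complex_of_real ((c s)\<^sup>2) * x s
        = complex_of_real ((s * p - R) / (4 * R)) * (complex_of_real (Y + s * R) * x s)"
      by (metis mult.assoc of_real_mult)
    then show ?thesis unfolding xw[OF that] .
  qed
  have "R > 0" using \<open>\<bar>Y\<bar> < R\<close> by linarith
  show "x 1 * cnj (x (- 1)) = - 1"
  proof -
    have "x 1 * cnj (x (- 1)) = complex_of_real ((R - Y) * (- R - Y)) / (w * cnj w)"
      by (simp add: x)
    also have "(R - Y) * (- R - Y) = - (R\<^sup>2 - Y\<^sup>2)"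
      by (simp add: algebra_simps power2_eq_square)
    finally show ?thesis
      using w by (simp only: ww[symmetric] of_real_minus) simp
  qed
  have sum: "(c 1)\<^sup>2 + (c (- 1))\<^sup>2 = (p - Y) / 2"
    using \<open>R > 0\<close> by (simp add: c2 field_simps)
  then show "(of_real (c 1))\<^sup>2 + (of_real (c (- 1)))\<^sup>2 = complex_of_real ((p - Y) / 2)"
    by (simp only: of_real_add[symmetric] of_real_power[symmetric])
  show "(of_real (c 1))\<^sup>2 * x 1 + (of_real (c (- 1)))\<^sup>2 * x (- 1) = - cnj w / 2"
  proof -
    have "(1 * p - R) / (4 * R) + (- 1 * p - R) / (4 * R) = - 1 / 2"
      using \<open>R > 0\<close> by (simp add: field_simps)
    then have "complex_of_real ((1 * p - R) / (4 * R)) * cnj w + complex_of_real ((- 1 * p - R) / (4 * R)) * cnj w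
        = complex_of_real (- 1 / 2) * cnj w"
      by (metis distrib_right of_real_add)
    then show ?thesis
      using cx[of 1] cx[of "- 1"] by simp
  qed
  \<comment> \<open>The two eigenvalues add up to the trace p, so this diagonal entry is p minus the
    one found in \<open>sum\<close>.\<close>
  have "(c 1)\<^sup>2 * (cmod (x 1))\<^sup>2 + (c (- 1))\<^sup>2 * (cmod (x (- 1)))\<^sup>2 = (p + Y) / 2"
    using lam[of 1] lam[of "- 1"] sum by (simp add: algebra_simps)
  then show "(of_real (c 1))\<^sup>2 * (x 1 * cnj (x 1)) + (of_real (c (- 1)))\<^sup>2 * (x (- 1) * cnj (x (- 1)))
      = complex_of_real ((p + Y) / 2)"
    unfolding complex_norm_square[symmetric]
    by (simp only: of_real_add[symmetric] of_real_mult[symmetric] of_real_power[symmetric])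
qed

section \<open>The channel and its Choi matrix in coordinates\<close>

lemma sgad_channel_entries:
  fixes A B G H Y :: real
  assumes E: "sgad_channel \<gamma>0 Nth r \<Phi> t E" and X: "X \<in> carrier_mat 2 2"
    and A: "A = sgad_A \<gamma>0 Nth r \<Phi> t" and B: "B = sgad_B \<gamma>0 Nth r \<Phi> t"
    and G: "G = sgad_G \<gamma>0 Nth r \<Phi> t" and H: "H = sgad_H \<gamma>0 Nth r t" and Y: "Y = sgad_Y \<gamma>0 Nth r t"
  shows "E X = mat_of_rows_list 2
    [[((1 + H - Y) * X $$ (0,0) + (1 - H - Y) * X $$ (1,1)) / 2,
      ((A + G) * X $$ (0,1) + (A - G + 2 * \<i> * B) * X $$ (1,0)) / 2],
     [((A - G - 2 * \<i> * B) * X $$ (0,1) + (A + G) * X $$ (1,0)) / 2,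
      ((1 - H + Y) * X $$ (0,0) + (1 + H + Y) * X $$ (1,1)) / 2]]"
proof -
  have *: "linear_map_mat2 E" "E (1\<^sub>m 2) = 1\<^sub>m 2 - Y \<cdot>\<^sub>m pauli_z"
    "E pauli_x = A \<cdot>\<^sub>m pauli_x - B \<cdot>\<^sub>m pauli_y"
    "E pauli_y = (- B) \<cdot>\<^sub>m pauli_x + G \<cdot>\<^sub>m pauli_y"
    "E pauli_z = H \<cdot>\<^sub>m pauli_z"
    using E by (simp_all add: sgad_channel_def Let_def A B G H Y)
  show ?thesis
    unfolding linear_map_mat2_expand[OF *(1) X] *(2-)
    by (subst mat2_eq_iff) (auto simp: mat_of_rows_list_def field_simps)
qed

lemma mat2_mult:
  "mat_of_rows_list 2 [[a, b], [c, d]] * mat_of_rows_list 2 [[a', b'], [c', d']] =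
   mat_of_rows_list 2 [[a * a' + b * c', a * b' + b * d'], [c * a' + d * c', c * b' + d * d' :: 'a :: semiring_0]]"
  by (rule eq_matI)
    (auto simp: mat_of_rows_list_def scalar_prod_def less_Suc_eq numeral_eq_Suc)

lemma mat2_add:
  "mat_of_rows_list 2 [[a, b], [c, d]] + mat_of_rows_list 2 [[a', b'], [c', d']] =
   mat_of_rows_list 2 [[a + a', b + b'], [c + c', d + d' :: 'a :: plus]]"
  by (rule eq_matI) (auto simp: mat_of_rows_list_def less_Suc_eq numeral_eq_Suc)

lemma mat2_smult:
  "k \<cdot>\<^sub>m mat_of_rows_list 2 [[a, b], [c, d]] = mat_of_rows_list 2 [[k * a, k * b], [k * c, k * d :: 'a :: times]]"
  by (rule eq_matI) (auto simp: mat_of_rows_list_def less_Suc_eq numeral_eq_Suc)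

lemma mat2_adjoint:
  "mat_adjoint (mat_of_rows_list 2 [[a, b], [c, d]]) =
   mat_of_rows_list 2 [[cnj a, cnj c], [cnj b, cnj d]]"
  by (rule eq_matI) (auto simp: mat_adjoint_def mat_of_rows_list_def mat_of_rows_def less_Suc_eq numeral_eq_Suc)

lemma mat2_eta:
  assumes "X \<in> carrier_mat 2 2"
  shows "X = mat_of_rows_list 2 [[X $$ (0,0), X $$ (0,1)], [X $$ (1,0), X $$ (1,1)]]"
  using assms by (intro eq_matI) (auto simp: mat_of_rows_list_def less_Suc_eq numeral_eq_Suc)

lemma mat4_mult_vec:
  "mat_of_rows_list 4 [[a00, a01, a02, a03], [a10, a11, a12, a13], [a20, a21, a22, a23], [a30, a31, a32, a33]]
     *\<^sub>v vec_of_list [x, y, z, w] =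
   vec_of_list [a00 * x + a01 * y + a02 * z + a03 * w, a10 * x + a11 * y + a12 * z + a13 * w,
     a20 * x + a21 * y + a22 * z + a23 * w, a30 * x + a31 * y + a32 * z + a33 * w :: 'a :: comm_semiring_0]"
  by (rule eq_vecI)
    (auto simp: mat_of_rows_list_def scalar_prod_def less_Suc_eq numeral_eq_Suc add.assoc)

lemma vec4_cscalar_prod:
  "vec_of_list [x, y, z, w] \<bullet>c vec_of_list [x', y', z', w'] =
   x * cnj x' + y * cnj y' + z * cnj z' + w * cnj w'"
  by (simp add: scalar_prod_def numeral_eq_Suc add.assoc)

lemma vec4_smult:
  "k \<cdot>\<^sub>v vec_of_list [x, y, z, w] = vec_of_list [k * x, k * y, k * z, k * w :: 'a :: times]"
  by (rule eq_vecI) (auto simp: less_Suc_eq numeral_eq_Suc)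

lemma choi_reshape_vec:
  "choi_reshape (vec_of_list [x, y, z, w]) = mat_of_rows_list 2 [[x, z], [y, w]]"
  by (rule eq_matI)
    (auto simp: choi_reshape_def mat_of_rows_list_def mat_of_cols_def vec_first_def vec_last_def
      less_Suc_eq numeral_eq_Suc)

text \<open>The projector onto |00> + |11> (unnormalised) is the sum of e_ij (x) e_ij, so its four
  blocks are the matrix units.\<close>

lemma choi_matrix_eq:
  fixes E
  defines "e \<equiv> \<lambda>i j. mat 2 2 (\<lambda>(a, b). if a = i \<and> b = j then 1 else 0)"
  shows "choi_matrix E = four_block_mat (E (e 0 0)) (E (e 0 1)) (E (e 1 0)) (E (e 1 1))"
proof -
  have "split_block (outer_prod ket_psi ket_psi) 2 2 = (e 0 0, e 0 1, e 1 0, e 1 1)"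
    unfolding split_block_def Let_def prod.inject
    by (intro conjI; rule eq_matI)
      (auto simp: e_def outer_prod_def ket_psi_def less_Suc_eq numeral_eq_Suc)
  then show ?thesis by (simp add: choi_matrix_def id_tensor_def)
qed

section \<open>Choi eigenvectors and the Kraus identity\<close>

theorem mainTheorem4:
  fixes \<gamma>0 Nth r \<Phi> t :: real
    and A B G H Y \<Psi> \<eta> :: real
    and M N :: "real \<Rightarrow> real"
    and J K :: "real \<Rightarrow> complex mat"
    and E :: "complex mat \<Rightarrow> complex mat"
  assumes "\<gamma>0 > 0" and "Nth \<ge> 0" and "t \<ge> 0"
    and "sgad_channel \<gamma>0 Nth r \<Phi> t E"
    and "A = sgad_A \<gamma>0 Nth r \<Phi> t"
    and "B = sgad_B \<gamma>0 Nth r \<Phi> t"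
    and "G = sgad_G \<gamma>0 Nth r \<Phi> t"
    and "H = sgad_H \<gamma>0 Nth r t"
    and "Y = sgad_Y \<gamma>0 Nth r t"
    and "2 * complex_of_real B + \<i> * complex_of_real (G - A) \<noteq> 0"
    and "\<Psi> = sqrt ((A - G)\<^sup>2 + 4 * B\<^sup>2 + Y\<^sup>2)"
    and "\<eta> = sqrt ((A + G)\<^sup>2 + Y\<^sup>2)"
    \<comment> \<open>the argument s of M, N, J, K is the sign, +1 or -1\<close>
    and "M = (\<lambda>s. sqrt 2 * sqrt (1 + (cmod (complex_of_real (\<Psi> - s * Y)
               / (2 * complex_of_real B + \<i> * complex_of_real (G - A))))\<^sup>2))"
    and "N = (\<lambda>s. sqrt 2 * sqrt (1 + \<bar>(Y + s * \<eta>) / (A + G)\<bar>\<^sup>2))"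
    and "J = (\<lambda>s. complex_of_real (sqrt (1 - H - s * \<Psi>) / M s) \<cdot>\<^sub>m
               mat_of_rows_list 2
                 [[0, 1],
                  [complex_of_real s * \<i> * complex_of_real (\<Psi> - s * Y)
                     / (2 * complex_of_real B + \<i> * complex_of_real (G - A)), 0]])"
    and "K = (\<lambda>s. complex_of_real (sqrt (1 + H - s * \<eta>) / N s) \<cdot>\<^sub>m
               mat_of_rows_list 2
                 [[- complex_of_real ((Y + s * \<eta>) / (A + G)), 0],
                  [0, 1]])"
  shows "from_choi_construction E [J 1, J (- 1), K 1, K (- 1)] \<and>
         (\<forall>\<rho> \<in> carrier_mat 2 2.
            E \<rho> = J 1 * \<rho> * mat_adjoint (J 1) + J (- 1) * \<rho> * mat_adjoint (J (- 1))
                + K 1 * \<rho> * mat_adjoint (K 1) + K (- 1) * \<rho> * mat_adjoint (K (- 1)))"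
proof -
  define D where "D = 2 * complex_of_real B + \<i> * complex_of_real (G - A)"
  \<comment> \<open>\<open>- wJ / 2\<close> and \<open>- wK / 2\<close> are the lower off-diagonal
    entries of the Choi blocks on |01>, |10> and on |00>, |11>. The diagonal of the second block
    carries Y with the opposite sign, so \<open>hermitian_block\<close> is applied there with -
    Y.\<close>
  define wJ wK where "wJ = - \<i> * D" and "wK = - complex_of_real (A + G)"
  define xJ xK where "xJ = (\<lambda>s. complex_of_real (s * \<Psi> - Y) / wJ)"
    and "xK = (\<lambda>s. complex_of_real (s * \<eta> - (- Y)) / wK)"
  define cJ cK where "cJ = (\<lambda>s. sqrt (1 - H - s * \<Psi>) / (sqrt 2 * sqrt (1 + (cmod (xJ s))\<^sup>2)))"
    and "cK = (\<lambda>s. sqrt (1 + H - s * \<eta>) / (sqrt 2 * sqrt (1 + (cmod (xK s))\<^sup>2)))"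
  have D: "D \<noteq> 0" using assms(10) by (simp add: D_def)
  then have "B \<noteq> 0 \<or> A \<noteq> G" by (auto simp: D_def)
  note pos = sgad_eigenvalues_pos[OF assms(1-3,5-9) this]
  have wJ: "wJ \<noteq> 0" using D by (simp add: wJ_def)
  have wK: "wK \<noteq> 0" using pos(3) by (simp add: wK_def flip: of_real_add)
  have wJ': "wJ = of_real (G - A) - 2 * \<i> * of_real B" "cnj wJ = of_real (G - A) + 2 * \<i> * of_real B"
    by (simp_all add: wJ_def D_def algebra_simps)
  have "(cmod wJ)\<^sup>2 = (A - G)\<^sup>2 + 4 * B\<^sup>2"
    unfolding wJ' by (simp add: cmod_power2 power2_commute[of A G] power_mult_distrib)
  then have RJ: "\<Psi> = sqrt ((cmod wJ)\<^sup>2 + Y\<^sup>2)" using assms(11) by simp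
  have RK: "\<eta> = sqrt ((cmod wK)\<^sup>2 + (- Y)\<^sup>2)"
    using assms(12) by (simp add: wK_def flip: of_real_add)
  have less: "\<Psi> < 1 - H" "\<eta> < 1 + H" using pos assms(11,12) by simp_all
  note blJ = hermitian_block[OF wJ RJ less(1) fun_cong[OF xJ_def] fun_cong[OF cJ_def]]
  note blK = hermitian_block[OF wK RK less(2) fun_cong[OF xK_def] fun_cong[OF cK_def],
    unfolded diff_minus_eq_add add_uminus_conv_diff]

  \<comment> \<open>The block eigenvectors c (x, 1), placed in the coordinates of their
    block.\<close>
  define vJ vK :: "real \<Rightarrow> complex vec"
    where "vJ = (\<lambda>s. vec_of_list [0, of_real (cJ s) * xJ s, of_real (cJ s), 0])"
      and "vK = (\<lambda>s. vec_of_list [of_real (cK s) * xK s, 0, 0, of_real (cK s)])"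
  have J: "J s = mat_of_rows_list 2 [[0, of_real (cJ s)], [of_real (cJ s) * xJ s, 0]]"
    if "s\<^sup>2 = 1" for s
  proof -
    \<comment> \<open>Here 1 / (- \<i>) = \<i>, and s (\<Psi> - s Y) = s \<Psi> - Y because s
      squares to 1.\<close>
    have "complex_of_real s * \<i> * complex_of_real (\<Psi> - s * Y) / D = xJ s"
      using that D by (simp add: xJ_def wJ_def field_simps power2_eq_square flip: of_real_mult)
    moreover have "cmod (complex_of_real (\<Psi> - s * Y) / D) = cmod (xJ s)"
      using that by (auto simp: xJ_def wJ_def norm_divide norm_mult power2_eq_1_iff simp flip: of_real_diff of_real_mult)
    ultimately have "J s = of_real (cJ s) \<cdot>\<^sub>m mat_of_rows_list 2 [[0, 1], [xJ s, 0]]"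
      unfolding assms(15,13) D_def[symmetric] cJ_def by simp
    then show ?thesis
      by (simp add: mat2_smult)
  qed
  have K: "K s = mat_of_rows_list 2 [[of_real (cK s) * xK s, 0], [0, of_real (cK s)]]" for s
  proof -
    have x: "- complex_of_real ((Y + s * \<eta>) / (A + G)) = xK s"
      unfolding xK_def wK_def divide_minus_right of_real_divide by (simp add: add.commute)
    have "cmod (xK s) = \<bar>(Y + s * \<eta>) / (A + G)\<bar>"
      unfolding x[symmetric] norm_minus_cancel norm_of_real ..
    then have "K s = of_real (cK s) \<cdot>\<^sub>m mat_of_rows_list 2 [[xK s, 0], [0, 1]]"
      unfolding assms(16,14) x cK_def by simp
    then show ?thesis
      by (simp add: mat2_smult)
  qed
  have E: "E X = mat_of_rows_list 2
      [[((1 + H - Y) * X $$ (0,0) + (1 - H - Y) * X $$ (1,1)) / 2,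
        - (cnj wK * X $$ (0,1) + wJ * X $$ (1,0)) / 2],
       [- (cnj wJ * X $$ (0,1) + wK * X $$ (1,0)) / 2,
        ((1 - H + Y) * X $$ (0,0) + (1 + H + Y) * X $$ (1,1)) / 2]]"
    if "X \<in> carrier_mat 2 2" for X
    unfolding sgad_channel_entries[OF assms(4) that assms(5-9)] wJ' wK_def
    by (simp add: algebra_simps)
  have choi: "choi_matrix E = mat_of_rows_list 4
      [[of_real ((1 + H - Y) / 2), 0, 0, - cnj wK / 2],
       [0, of_real ((1 - H + Y) / 2), - cnj wJ / 2, 0],
       [0, - wJ / 2, of_real ((1 - H - Y) / 2), 0],
       [- wK / 2, 0, 0, of_real ((1 + H + Y) / 2)]]"
    unfolding choi_matrix_eq
    by (rule eq_matI)
      (auto simp: E four_block_mat_def Let_def mat_of_rows_list_def less_Suc_eq numeral_eq_Suc)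
  have dim: "dim_row (choi_matrix E) = 4" by (simp add: choi mat_of_rows_list_def)
  have carr: "vJ s \<in> carrier_vec 4" "vK s \<in> carrier_vec 4" for s
    by (auto simp: vJ_def vK_def numeral_eq_Suc intro!: carrier_vecI)
  have eJ: "eigenvector (choi_matrix E) (vJ s) (of_real ((1 - H - s * \<Psi>) / 2))" if s: "s\<^sup>2 = 1" for s
  proof -
    have "vJ s $ 2 \<noteq> 0" using blJ(1)[OF s] by (simp add: vJ_def numeral_eq_Suc)
    then have "vJ s \<noteq> 0\<^sub>v 4" by auto
    moreover have "choi_matrix E *\<^sub>v vJ s = of_real ((1 - H - s * \<Psi>) / 2) \<cdot>\<^sub>v vJ s"
      unfolding choi vJ_def
      unfolding mat4_mult_vec vec4_smult using blJ(2,3)[OF s]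
      by (simp only: mult_zero_left mult_zero_right add_0_left add_0_right)
    ultimately show ?thesis
      by (simp add: eigenvector_def dim carr)
  qed
  have eK: "eigenvector (choi_matrix E) (vK s) (of_real ((1 + H - s * \<eta>) / 2))" if s: "s\<^sup>2 = 1" for s
  proof -
    have "vK s $ 3 \<noteq> 0" using blK(1)[OF s] by (simp add: vK_def numeral_eq_Suc)
    then have "vK s \<noteq> 0\<^sub>v 4" by auto
    moreover have "choi_matrix E *\<^sub>v vK s = of_real ((1 + H - s * \<eta>) / 2) \<cdot>\<^sub>v vK s"
      unfolding choi vK_def
      unfolding mat4_mult_vec vec4_smult using blK(2,3)[OF s]
      by (simp only: mult_zero_left mult_zero_right add_0_left add_0_right)
    ultimately show ?thesis
      by (simp add: eigenvector_def dim carr)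
  qed
  have nJ: "vJ s \<bullet>c vJ s = of_real ((1 - H - s * \<Psi>) / 2)" if "s\<^sup>2 = 1" for s
    unfolding blJ(4)[OF that, symmetric] vJ_def unfolding vec4_cscalar_prod
    by (simp add: algebra_simps power2_eq_square)
  have nK: "vK s \<bullet>c vK s = of_real ((1 + H - s * \<eta>) / 2)" if "s\<^sup>2 = 1" for s
    unfolding blK(4)[OF that, symmetric] vK_def unfolding vec4_cscalar_prod
    by (simp add: algebra_simps power2_eq_square)
  have "0 \<le> \<Psi>" "0 \<le> \<eta>" using RJ RK by simp_all
  \<comment> \<open>\<open>corthogonal\<close> demands nonzero self-products. These are the
    eigenvalues: s = 1 is \<open>less\<close>, and s = -1 uses that \<Psi> and \<eta> are
    nonnegative.\<close>
  then have nz: "vJ s \<bullet>c vJ s \<noteq> 0" "vK s \<bullet>c vK s \<noteq> 0" if "s\<^sup>2 = 1" for s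
    using less that unfolding nJ[OF that] nK[OF that] of_real_eq_0_iff
    by (auto simp: power2_eq_1_iff)
  \<comment> \<open>Within a block the inner product is a real multiple of x cnj y + 1;
    \<open>corthogonal\<close> ranges over ordered pairs, so both orders are provided.\<close>
  have orth: "of_real k * (x * cnj y) + of_real k = 0" "of_real k * (y * cnj x) + of_real k = 0"
    if "x * cnj y = - 1" for x y and k :: real
  proof -
    have "y * cnj x = - 1" using arg_cong[OF that, of cnj] by (simp add: mult.commute)
    then show "of_real k * (x * cnj y) + of_real k = 0" "of_real k * (y * cnj x) + of_real k = 0"
      using that by simp_all
  qed
  have oJ: "vJ 1 \<bullet>c vJ (- 1) = 0" "vJ (- 1) \<bullet>c vJ 1 = 0"
    using orth[OF blJ(5), of "cJ 1 * cJ (- 1)"] unfolding vJ_def unfolding vec4_cscalar_prod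
    by (simp_all add: ac_simps)
  have oK: "vK 1 \<bullet>c vK (- 1) = 0" "vK (- 1) \<bullet>c vK 1 = 0"
    using orth[OF blK(5), of "cK 1 * cK (- 1)"] unfolding vK_def unfolding vec4_cscalar_prod
    by (simp_all add: ac_simps)
  \<comment> \<open>Vectors from different blocks have disjoint supports.\<close>
  have oJK: "vJ s \<bullet>c vK s' = 0" "vK s' \<bullet>c vJ s = 0" for s s'
    unfolding vJ_def vK_def unfolding vec4_cscalar_prod by simp_all
  have "corthogonal [vJ 1, vJ (- 1), vK 1, vK (- 1)]"
    unfolding corthogonal_def using nz oJ oK oJK
    by (auto simp: less_Suc_eq split: if_splits)
  moreover have "[J 1, J (- 1), K 1, K (- 1)] = map choi_reshape [vJ 1, vJ (- 1), vK 1, vK (- 1)]"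
    by (simp add: J K vJ_def vK_def choi_reshape_vec del: vec_of_list_Cons)
  moreover have "\<exists>ev::real. eigenvector (choi_matrix E) (vJ s) (of_real ev) \<and> vJ s \<bullet>c vJ s = of_real ev"
    "\<exists>ev::real. eigenvector (choi_matrix E) (vK s) (of_real ev) \<and> vK s \<bullet>c vK s = of_real ev"
    if "s\<^sup>2 = 1" for s
    using eJ[OF that] nJ[OF that] eK[OF that] nK[OF that] by blast+
  ultimately have "from_choi_construction E [J 1, J (- 1), K 1, K (- 1)]"
    unfolding from_choi_construction_def
    by (intro exI[of _ "[vJ 1, vJ (- 1), vK 1, vK (- 1)]"]) simp
  moreover have "E \<rho> = J 1 * \<rho> * mat_adjoint (J 1) + J (- 1) * \<rho> * mat_adjoint (J (- 1))
                + K 1 * \<rho> * mat_adjoint (K 1) + K (- 1) * \<rho> * mat_adjoint (K (- 1))"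
    if "\<rho> \<in> carrier_mat 2 2" for \<rho>
  proof -
    define a b c d where "a = \<rho> $$ (0,0)" and "b = \<rho> $$ (0,1)" and "c = \<rho> $$ (1,0)" and "d = \<rho> $$ (1,1)"
    have \<rho>: "\<rho> = mat_of_rows_list 2 [[a, b], [c, d]]"
      using mat2_eta[OF that] by (simp add: a_def b_def c_def d_def)
    note jk = blJ(6-8) blK(6-8) arg_cong[OF blJ(7), of cnj] arg_cong[OF blK(7), of cnj]
    define k1 k2 k3 k4 where "k1 = complex_of_real (cJ 1)" and "k2 = complex_of_real (cJ (- 1))"
      and "k3 = complex_of_real (cK 1)" and "k4 = complex_of_real (cK (- 1))"
    define x1 x2 x3 x4 where "x1 = xJ 1" and "x2 = xJ (- 1)" and "x3 = xK 1" and "x4 = xK (- 1)"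
    note fold_names = k1_def[symmetric] k2_def[symmetric] k3_def[symmetric] k4_def[symmetric]
      x1_def[symmetric] x2_def[symmetric] x3_def[symmetric] x4_def[symmetric]
    have [simp]: "cnj k1 = k1" "cnj k2 = k2" "cnj k3 = k3" "cnj k4 = k4"
      by (simp_all add: k1_def k2_def k3_def k4_def)
    \<comment> \<open>Each block is the sum of the rank-one matrices of its two eigenvectors; these
      are its entries.\<close>
    have J00: "k1\<^sup>2 + k2\<^sup>2 = (1 - H - Y) / 2"
      and J01: "k1\<^sup>2 * x1 + k2\<^sup>2 * x2 = - cnj wJ / 2"
      and J11: "k1\<^sup>2 * (x1 * cnj x1) + k2\<^sup>2 * (x2 * cnj x2) = (1 - H + Y) / 2"
      using blJ(6-8) unfolding fold_names by simp_all
    have K00: "k3\<^sup>2 + k4\<^sup>2 = (1 + H + Y) / 2"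
      and K01: "k3\<^sup>2 * x3 + k4\<^sup>2 * x4 = - cnj wK / 2"
      and K11: "k3\<^sup>2 * (x3 * cnj x3) + k4\<^sup>2 * (x4 * cnj x4) = (1 + H - Y) / 2"
      using blK(6-8) unfolding fold_names by simp_all
    have J10: "k1\<^sup>2 * cnj x1 + k2\<^sup>2 * cnj x2 = - wJ / 2"
      using arg_cong[OF J01, of cnj] by simp
    have K10: "k3\<^sup>2 * cnj x3 + k4\<^sup>2 * cnj x4 = - wK / 2"
      using arg_cong[OF K01, of cnj] by simp
    \<comment> \<open>The diagonal K's keep the positions of the entries of \<rho> and the
      antidiagonal J's reverse both indices; every resulting coefficient is an entry of one of the
      rank-one sums.\<close>
    have "J 1 * \<rho> * mat_adjoint (J 1) + J (- 1) * \<rho> * mat_adjoint (J (- 1))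
        + K 1 * \<rho> * mat_adjoint (K 1) + K (- 1) * \<rho> * mat_adjoint (K (- 1)) =
      mat_of_rows_list 2
       [[(k3\<^sup>2 * (x3 * cnj x3) + k4\<^sup>2 * (x4 * cnj x4)) * a + (k1\<^sup>2 + k2\<^sup>2) * d,
         (k3\<^sup>2 * x3 + k4\<^sup>2 * x4) * b + (k1\<^sup>2 * cnj x1 + k2\<^sup>2 * cnj x2) * c],
        [(k1\<^sup>2 * x1 + k2\<^sup>2 * x2) * b + (k3\<^sup>2 * cnj x3 + k4\<^sup>2 * cnj x4) * c,
         (k1\<^sup>2 * (x1 * cnj x1) + k2\<^sup>2 * (x2 * cnj x2)) * a + (k3\<^sup>2 + k4\<^sup>2) * d]]"
      by (simp add: J K \<rho> mat2_mult mat2_add mat2_adjoint fold_names algebra_simps power2_eq_square)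
    also have "\<dots> = E \<rho>"
      unfolding E[OF that] J00 J01 J10 J11 K00 K01 K10 K11
        a_def[symmetric] b_def[symmetric] c_def[symmetric] d_def[symmetric]
      by (simp add: algebra_simps add_divide_distrib diff_divide_distrib)
    finally show ?thesis ..
  qed
  ultimately show ?thesis by blast
qed

end
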